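(* Let $\tau:S(V)\to\mathbb{C}$ be the linear map given by the ensemble of 1PI $n$-point functions, and let $\sigma^k:=\tau^{\otimes k}\circ\Lambda^{k-1}:S(V)\to\mathbb C$ for $k\ge1$. Then $\sigma^k$ is determined recursively by $\sigma^1=\tau$ and, for $k>1$, $$\sigma^{k}=\frac{1}{k-1}\sum_{i=1}^{k-1}(\sigma^i\otimes\sigma^{k-i})\circ Q .$$
   Context: $V$ is the complex vector space of finite linear combinations of field operators $\phi(x)$, $x$ ranging over a set of labels (purely bosonic case). $S(V)$ is the (commutative) symmetric algebra over $V$ with unit $\mathbf 1$. The coproduct $\Delta:S(V)\to S(V)\otimes S(V)$ is the algebra homomorphism with $\Delta(\mathbf 1)=\mathbf 1\otimes\mathbf 1$, $\Delta(\phi(x))=\phi(x)\otimes\mathbf 1+\mathbf 1\otimes\phi(x)$. $G_F(x,y)=G_F(y,x)$ is the Feynman propagator, with inverse $G_F^{-1}$ determined by $\int dy\,G_F(x,y)G_F^{-1}(y,z)=\delta(x,z)$ ($\int dx$ denotes integration/summation over labels and is used formally: linear forms are evaluated under the integral sign). Put $R:=\int dx\,dy\,G_F^{-1}(x,y)\,(\phi(x)\otimes\phi(y))$, a formal (symmetric) element of (a completion of) $S(V)\otimes S(V)$, also viewed as the operator of multiplication by $R$. Put $Q:=\frac12 R\circ\Delta:S(V)\to S(V)\otimes S(V)$ and $Q_i:=\mathrm{id}^{\otimes i-1}\otimes Q\otimes\mathrm{id}^{\otimes k-i}:S(V)^{\otimes k}\to S(V)^{\otimes k+1}$. Maps $\Lambda^k:S(V)\to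 S(V)^{\otimes k+1}$ are defined by $\Lambda^0:=\mathrm{id}$ and $\Lambda^k:=\frac1k\sum_{i=1}^kQ_i\circ\Lambda^{k-1}$ for $k\ge1$. $\tau(\phi(x_1)\cdots\phi(x_n))$ is the 1PI $n$-point function; $\tau(\mathbf 1)=0$ and $\tau(\phi(x))=0$. *)

theory Defs
  imports
    "HOL-Library.Multiset"
    "HOL-Library.Poly_Mapping"
    "HOL-Library.Product_Plus"
    Complex_Main
begin

section \<open>Finitely supported linear combinations\<close>

definition scale :: "complex \<Rightarrow> ('b \<Rightarrow>\<^sub>0 complex) \<Rightarrow> ('b \<Rightarrow>\<^sub>0 complex)" where
  "scale c t = Poly_Mapping.map ((*) c) t"

abbreviation basis :: "'b \<Rightarrow> ('b \<Rightarrow>\<^sub>0 complex)" where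
  "basis b \<equiv> Poly_Mapping.single b 1"

text \<open>The linear extension of a function prescribed on the basis vectors, with values in \<open>\<complex>\<close>
  and with values in another free vector space.\<close>

definition lin_form :: "('b \<Rightarrow> complex) \<Rightarrow> ('b \<Rightarrow>\<^sub>0 complex) \<Rightarrow> complex" where
  "lin_form f t = (\<Sum>b\<in>Poly_Mapping.keys t. Poly_Mapping.lookup t b * f b)"

definition lin_map :: "('b \<Rightarrow> ('c \<Rightarrow>\<^sub>0 complex)) \<Rightarrow> ('b \<Rightarrow>\<^sub>0 complex) \<Rightarrow> ('c \<Rightarrow>\<^sub>0 complex)" where
  "lin_map F t = (\<Sum>b\<in>Poly_Mapping.keys t. scale (Poly_Mapping.lookup t b) (F b))"


section \<open>The symmetric algebra and its tensor powers\<close>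

text \<open>
  The space \<open>V\<close> has the basis \<open>\<phi>(x)\<close>, with \<open>x\<close> ranging over the type of labels, so \<open>S(V)\<close> has the
  basis of monomials \<open>\<phi>(x\<^sub>1)\<cdots>\<phi>(x\<^sub>n)\<close>, that is, of finite multisets of labels.  Its product is the
  convolution product of \<^typ>\<open>'x multiset \<Rightarrow>\<^sub>0 complex\<close>.  Pairs of monomials are a basis
  of \<open>S(V) \<otimes> S(V)\<close>, and the convolution product is again the product of that algebra.
  Lists of \<open>k\<close> monomials are a basis of \<open>S(V)\<^sup>\<otimes>\<^sup>k\<close>; the type \<open>'x tens\<close> is the direct sum of these
  spaces over all \<open>k\<close>.
\<close>

type_synonym 'x sym = "'x multiset \<Rightarrow>\<^sub>0 complex"
type_synonym 'x sym2 = "('x multiset \<times> 'x multiset) \<Rightarrow>\<^sub>0 complex"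
type_synonym 'x tens = "'x multiset list \<Rightarrow>\<^sub>0 complex"

definition phi :: "'x \<Rightarrow> 'x sym" where
  "phi x = basis {#x#}"

definition tensor2 :: "'x sym \<Rightarrow> 'x sym \<Rightarrow> 'x sym2" where
  "tensor2 a b = lin_map (\<lambda>m. lin_map (\<lambda>n. basis (m, n)) b) a"

definition form_tensor2 :: "('x sym \<Rightarrow> complex) \<Rightarrow> ('x sym \<Rightarrow> complex) \<Rightarrow> 'x sym2 \<Rightarrow> complex" where
  "form_tensor2 f g = lin_form (\<lambda>(m, n). f (basis m) * g (basis n))"

definition form_power :: "nat \<Rightarrow> ('x sym \<Rightarrow> complex) \<Rightarrow> 'x tens \<Rightarrow> complex" where
  "form_power k f = lin_form (\<lambda>u. if length u = k then (\<Prod>m\<leftarrow>u. f (basis m)) else 0)"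

definition tens_of_sym :: "'x sym \<Rightarrow> 'x tens" where
  "tens_of_sym = lin_map (\<lambda>m. basis [m])"

definition tens_of_sym2 :: "'x sym2 \<Rightarrow> 'x tens" where
  "tens_of_sym2 = lin_map (\<lambda>(m, n). basis [m, n])"

definition tensor :: "'x tens \<Rightarrow> 'x tens \<Rightarrow> 'x tens" where
  "tensor s t = lin_map (\<lambda>u. lin_map (\<lambda>v. basis (u @ v)) t) s"

definition coprod :: "'x sym \<Rightarrow> 'x sym2" where
  "coprod = lin_map (\<lambda>m. \<Prod>x\<in>#m. tensor2 (phi x) 1 + tensor2 1 (phi x))"


section \<open>Formal integrals\<close>

text \<open>
  Formal integrals enter only through the value that a linear form takes on them, the form being
  evaluated under the integral sign.  Accordingly an element of the completion of a space is
  represented by this functional of linear forms; an element \<open>v\<close> of the space itself is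
  represented by \<open>\<lambda>\<omega>. \<omega> v\<close>.

  The generalised function \<open>G\<^sub>F\<^sup>-\<^sup>1(x,y)\<close> is represented by the functional
  \<open>K f = \<integral>dx dy G\<^sub>F\<^sup>-\<^sup>1(x,y) f(x,y)\<close>.  Taking instead the evaluation functional \<open>\<lambda>f. f (x, y)\<close>
  for \<open>K\<close> in the definitions below removes the integral and leaves its integrand at \<open>(x, y)\<close>.
\<close>

type_synonym 'v formal = "('v \<Rightarrow> complex) \<Rightarrow> complex"
type_synonym 'x kernel = "('x \<times> 'x \<Rightarrow> complex) \<Rightarrow> complex"

definition R :: "'x kernel \<Rightarrow> 'x sym2 formal" where
  "R K = (\<lambda>\<omega>. K (\<lambda>(x, y). \<omega> (tensor2 (phi x) (phi y))))"

definition mult_R :: "'x kernel \<Rightarrow> 'x sym2 \<Rightarrow> 'x sym2 formal" where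
  "mult_R K u = (\<lambda>\<omega>. R K (\<lambda>r. \<omega> (r * u)))"

definition Q :: "'x kernel \<Rightarrow> 'x sym \<Rightarrow> 'x sym2 formal" where
  "Q K a = (\<lambda>\<omega>. (1 / 2) * mult_R K (coprod a) \<omega>)"

text \<open>The map \<open>Q\<^sub>i = id\<^sup>\<otimes>\<^sup>i\<^sup>-\<^sup>1 \<otimes> Q \<otimes> id\<^sup>\<otimes>\<^sup>k\<^sup>-\<^sup>i\<close>: first on the basis of \<open>S(V)\<^sup>\<otimes>\<^sup>k\<close> (lists \<open>u\<close> of
  length \<open>k\<close>, with \<open>1 \<le> i \<le> k\<close>), then on formal elements.\<close>

definition Q_basis :: "'x kernel \<Rightarrow> nat \<Rightarrow> 'x multiset list \<Rightarrow> 'x tens formal" where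
  "Q_basis K i u = (\<lambda>\<omega>. Q K (basis (u ! (i - 1)))
     (\<lambda>t. \<omega> (tensor (basis (take (i - 1) u)) (tensor (tens_of_sym2 t) (basis (drop i u))))))"

definition Q_at :: "'x kernel \<Rightarrow> nat \<Rightarrow> 'x tens formal \<Rightarrow> 'x tens formal" where
  "Q_at K i \<Psi> = (\<lambda>\<omega>. \<Psi> (lin_form (\<lambda>u. Q_basis K i u \<omega>)))"

primrec Lambda :: "'x kernel \<Rightarrow> nat \<Rightarrow> 'x sym \<Rightarrow> 'x tens formal" where
  "Lambda K 0 a = (\<lambda>\<omega>. \<omega> (tens_of_sym a))"
| "Lambda K (Suc k) a =
     (\<lambda>\<omega>. (1 / of_nat (Suc k)) * (\<Sum>i = 1..Suc k. Q_at K i (Lambda K k a) \<omega>))"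

definition sigma :: "'x kernel \<Rightarrow> ('x sym \<Rightarrow> complex) \<Rightarrow> nat \<Rightarrow> 'x sym \<Rightarrow> complex" where
  "sigma K \<tau> k a = Lambda K (k - 1) a (form_power k \<tau>)"

text \<open>
  The rules for manipulating formal integrals.  A member of \<open>adm\<close> is a function of
  label pairs \<open>\<rho> 0, \<rho> 1, \<dots>\<close> for which the integrals against the kernel make sense; on these,
  integration is linear, integrations over different pairs commute, and integrating over one of the
  pairs leads to an admissible function of the remaining ones.  For finitely many labels every
  function is admissible, see \<open>feynman_kernel_finite\<close> below.

  The last axiom is \<open>\<integral>dy G\<^sub>F(x,y) G\<^sub>F\<^sup>-\<^sup>1(y,z) = \<delta>(x,z)\<close>, read as an equality of generalised functions
  of \<open>z\<close>: \<open>\<integral>dy dz G\<^sub>F(x,y) G\<^sub>F\<^sup>-\<^sup>1(y,z) f(z) = f(x)\<close> whenever the integrand is admissible.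
\<close>

locale feynman_kernel =
  fixes adm :: "((nat \<Rightarrow> 'x \<times> 'x) \<Rightarrow> complex) set"
    and K :: "'x kernel"
    and G :: "'x \<Rightarrow> 'x \<Rightarrow> complex"
  assumes adm_zero: "(\<lambda>\<rho>. 0) \<in> adm"
    and adm_add: "f \<in> adm \<Longrightarrow> g \<in> adm \<Longrightarrow> (\<lambda>\<rho>. f \<rho> + g \<rho>) \<in> adm"
    and adm_mult: "f \<in> adm \<Longrightarrow> (\<lambda>\<rho>. c * f \<rho>) \<in> adm"
    and adm_rename: "f \<in> adm \<Longrightarrow> bij \<pi> \<Longrightarrow> (\<lambda>\<rho>. f (\<rho> \<circ> \<pi>)) \<in> adm"
    and adm_integral: "f \<in> adm \<Longrightarrow> (\<lambda>\<rho>. K (\<lambda>p. f (\<rho>(i := p)))) \<in> adm"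
    and integral_add: "f \<in> adm \<Longrightarrow> g \<in> adm \<Longrightarrow>
      K (\<lambda>p. f (\<rho>(i := p)) + g (\<rho>(i := p))) = K (\<lambda>p. f (\<rho>(i := p))) + K (\<lambda>p. g (\<rho>(i := p)))"
    and integral_mult: "f \<in> adm \<Longrightarrow> K (\<lambda>p. c * f (\<rho>(i := p))) = c * K (\<lambda>p. f (\<rho>(i := p)))"
    and integral_commute: "f \<in> adm \<Longrightarrow> i \<noteq> j \<Longrightarrow>
      K (\<lambda>p. K (\<lambda>q. f (\<rho>(i := p, j := q)))) = K (\<lambda>q. K (\<lambda>p. f (\<rho>(i := p, j := q))))"
    and integral_symmetric: "f \<in> adm \<Longrightarrow>
      K (\<lambda>p. f (\<rho>(i := prod.swap p))) = K (\<lambda>p. f (\<rho>(i := p)))"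
    and G_symmetric: "G x y = G y x"
    and G_inverse: "(\<And>x. (\<lambda>\<rho>. G x (fst (\<rho> 0)) * h (snd (\<rho> 0))) \<in> adm) \<Longrightarrow>
      K (\<lambda>(y, z). G x y * h z) = h x"

text \<open>
  The composition \<open>Q\<^bsub>w(n-1)\<^esub> \<circ> \<cdots> \<circ> Q\<^bsub>w(0)\<^esub>\<close>, with a separate kernel for each factor.  With evaluation
  functionals as kernels it yields the integrand of the corresponding \<open>n\<close>-fold integral, and
  \<open>integrals_exist\<close> says that the integrals of which the forms \<open>\<sigma>\<^sup>k\<close> consist make sense.
\<close>

primrec Q_word :: "(nat \<Rightarrow> 'x kernel) \<Rightarrow> (nat \<Rightarrow> nat) \<Rightarrow> nat \<Rightarrow> 'x sym \<Rightarrow> 'x tens formal" where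
  "Q_word Ks w 0 a = (\<lambda>\<omega>. \<omega> (tens_of_sym a))"
| "Q_word Ks w (Suc n) a = Q_at (Ks n) (w n) (Q_word Ks w n a)"

definition integrals_exist ::
  "((nat \<Rightarrow> 'x \<times> 'x) \<Rightarrow> complex) set \<Rightarrow> ('x sym \<Rightarrow> complex) \<Rightarrow> bool" where
  "integrals_exist adm \<tau> \<longleftrightarrow>
     (\<forall>n w a. (\<forall>j<n. w j \<in> {1..Suc j}) \<longrightarrow>
        (\<lambda>\<rho>. Q_word (\<lambda>j f. f (\<rho> j)) w n a (form_power (Suc n) \<tau>)) \<in> adm)"


section \<open>Consistency checks\<close>

lemma lookup_scale [simp]: "Poly_Mapping.lookup (scale c t) b = c * Poly_Mapping.lookup t b"
  by (simp add: scale_def Poly_Mapping.map.rep_eq when_def)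

lemma vector_space_scale: "vector_space scale"
  by unfold_locales (rule poly_mapping_eqI; simp add: lookup_add algebra_simps)+

lemma scale_add: "scale c (s + t) = scale c s + scale c t" "scale (c + d) t = scale c t + scale d t"
  by (rule poly_mapping_eqI; simp add: lookup_add algebra_simps)+

lemma scale_zero: "scale 0 t = 0"
  by (rule poly_mapping_eqI) simp

lemma scale_single: "scale c (Poly_Mapping.single b d) = Poly_Mapping.single b (c * d)"
  by (rule poly_mapping_eqI) (simp add: lookup_single when_def)

lemma lin_comb_induct [case_names single sum]:
  fixes t :: "'b \<Rightarrow>\<^sub>0 complex"
  assumes single: "\<And>b c. P (Poly_Mapping.single b c)"
    and sum: "\<And>s t. P s \<Longrightarrow> P t \<Longrightarrow> P (s + t)"
  shows "P t"
proof -
  have zero: "P 0"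
    using single[of undefined 0] by simp
  have "P (\<Sum>b\<in>A. Poly_Mapping.single b (Poly_Mapping.lookup t b))" if "finite A" for A
    using that by (induction A rule: finite_induct) (simp_all add: zero single sum)
  moreover have "t = (\<Sum>b\<in>Poly_Mapping.keys t. Poly_Mapping.single b (Poly_Mapping.lookup t b))"
    by (rule poly_mapping_eqI)
      (simp add: lookup_sum lookup_single when_def in_keys_iff sum.delta' if_distrib cong: if_cong)
  ultimately show ?thesis
    by (metis finite_keys)
qed

lemma scale_conv_mult: "scale c (t :: 'm::comm_monoid_add \<Rightarrow>\<^sub>0 complex) = Poly_Mapping.single 0 c * t"
  by (induction t rule: lin_comb_induct)
    (simp_all add: mult_single scale_single scale_add algebra_simps)

lemma lin_map_superset:
  assumes "finite A" "Poly_Mapping.keys t \<subseteq> A"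
  shows "lin_map F t = (\<Sum>b\<in>A. scale (Poly_Mapping.lookup t b) (F b))"
  unfolding lin_map_def using assms
  by (intro sum.mono_neutral_left) (auto simp: in_keys_iff scale_zero)

lemma lin_map_add: "lin_map F (s + t) = lin_map F s + lin_map F t"
proof -
  let ?A = "Poly_Mapping.keys s \<union> Poly_Mapping.keys t"
  have "lin_map F r = (\<Sum>b\<in>?A. scale (Poly_Mapping.lookup r b) (F b))" if "r \<in> {s, t, s + t}" for r
    using that keys_add[of s t] by (intro lin_map_superset) auto
  then show ?thesis
    by (simp add: lookup_add sum.distrib scale_add)
qed

lemma lin_map_single: "lin_map F (Poly_Mapping.single b c) = scale c (F b)"
  by (subst lin_map_superset[of "{b}"]) auto

lemma coprod_add: "coprod (a + b) = coprod a + coprod b"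
  by (simp add: coprod_def lin_map_add)

lemma coprod_one: "coprod 1 = 1"
proof -
  have "coprod (basis 0) = 1"
    unfolding coprod_def lin_map_single by (rule poly_mapping_eqI) simp
  then show ?thesis
    by simp
qed

lemma coprod_phi: "coprod (phi x) = tensor2 (phi x) 1 + tensor2 1 (phi x)"
  unfolding coprod_def phi_def lin_map_single by (rule poly_mapping_eqI) simp

lemma coprod_single:
  "coprod (Poly_Mapping.single m c) =
    Poly_Mapping.single 0 c * (\<Prod>x\<in>#m. tensor2 (phi x) 1 + tensor2 1 (phi x))"
  by (simp add: coprod_def lin_map_single scale_conv_mult)

lemma coprod_scale: "coprod (scale c a) = scale c (coprod a)"
  by (induction a rule: lin_comb_induct)
    (simp_all add: scale_single scale_add coprod_single coprod_add scale_conv_mult mult_single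
      distrib_left flip: mult.assoc)

lemma coprod_mult: "coprod (a * b) = coprod a * coprod b"
proof (induction a rule: lin_comb_induct)
  case (single m c)
  show ?case
  proof (induction b rule: lin_comb_induct)
    case (single n d)
    have "Poly_Mapping.single 0 (c * d) = (Poly_Mapping.single 0 c * Poly_Mapping.single 0 d :: 'a sym2)"
      by (simp add: mult_single)
    then show ?case
      by (simp add: mult_single[of m] coprod_single mult_ac)
  qed (simp add: coprod_add algebra_simps)
qed (simp add: coprod_add algebra_simps)

lemma feynman_kernel_finite:
  fixes G H :: "'x::finite \<Rightarrow> 'x \<Rightarrow> complex"
  assumes sym: "\<And>x y. G x y = G y x"
    and inv: "\<And>x z. (\<Sum>y\<in>UNIV. G x y * H y z) = (if x = z then 1 else 0)"
  shows "feynman_kernel UNIV (\<lambda>f. \<Sum>x\<in>UNIV. \<Sum>y\<in>UNIV. H x y * f (x, y)) G"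
proof -
  have H_sym: "H x y = H y x" for x y
  proof -
    have "(\<Sum>u\<in>UNIV. H u x * (\<Sum>v\<in>UNIV. G u v * H v y)) = H y x"
      by (simp add: inv if_distrib cong: if_cong)
    moreover have "(\<Sum>u\<in>UNIV. H u x * (\<Sum>v\<in>UNIV. G u v * H v y))
        = (\<Sum>u\<in>UNIV. \<Sum>v\<in>UNIV. G v u * H u x * H v y)"
      unfolding sum_distrib_left by (intro sum.cong refl) (metis sym mult.assoc mult.commute)
    moreover have "\<dots> = (\<Sum>v\<in>UNIV. (\<Sum>u\<in>UNIV. G v u * H u x) * H v y)"
      by (subst sum.swap) (simp add: sum_distrib_right)
    ultimately show ?thesis
      by (simp add: inv if_distrib[of "\<lambda>t. t * _"] cong: if_cong)
  qed
  show ?thesis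
  proof (unfold_locales, goal_cases)
    case (6 f g \<rho> i)
    show ?case by (simp add: algebra_simps sum.distrib)
  next
    case (7 f c \<rho> i)
    show ?case by (simp add: sum_distrib_left mult_ac)
  next
    case (8 f i j \<rho>)
    have pairs: "(\<Sum>x\<in>UNIV. \<Sum>y\<in>UNIV. H x y * g (x, y)) = (\<Sum>p\<in>UNIV. H (fst p) (snd p) * g p)"
      for g
      by (simp add: sum.cartesian_product case_prod_unfold)
    have "(\<Sum>p\<in>UNIV. H (fst p) (snd p) * (\<Sum>q\<in>UNIV. H (fst q) (snd q) * f (\<rho>(i := p, j := q))))
        = (\<Sum>q\<in>UNIV. H (fst q) (snd q) * (\<Sum>p\<in>UNIV. H (fst p) (snd p) * f (\<rho>(i := p, j := q))))"
      unfolding sum_distrib_left by (subst sum.swap) (simp only: mult.left_commute)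
    then show ?case
      by (simp only: pairs[of "\<lambda>p. f (_(i := p, j := _))"] pairs[of "\<lambda>q. f (_(i := _, j := q))"]
        pairs[of "\<lambda>p. \<Sum>q\<in>UNIV. H (fst q) (snd q) * f (\<rho>(i := p, j := q))"]
        pairs[of "\<lambda>q. \<Sum>p\<in>UNIV. H (fst p) (snd p) * f (\<rho>(i := p, j := q))"])
  next
    case (9 f \<rho> i)
    show ?case by (subst sum.swap) (subst H_sym, simp)
  next
    case (10 x y)
    show ?case by (rule sym)
  next
    case (11 h x)
    have "(\<Sum>y\<in>UNIV. \<Sum>z\<in>UNIV. H y z * (G x y * h z)) = (\<Sum>z\<in>UNIV. (\<Sum>y\<in>UNIV. G x y * H y z) * h z)"
      by (subst sum.swap) (simp add: sum_distrib_left sum_distrib_right mult_ac)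
    then show ?case
      by (simp add: inv if_distrib[of "\<lambda>t. t * _"] cong: if_cong)
  qed auto
qed

end

theory Submission
  imports Defs
begin

text \<open>
  Expanding \<open>\<Lambda>\<^sup>k\<^sup>-\<^sup>1\<close> and dualising, \<open>(k-1)! \<sigma>\<^sup>k\<close> is the sum over all ways of contracting a row of
  \<open>k\<close> copies of \<open>\<tau>\<close> to a single form, where each step replaces two neighbours \<open>f, g\<close> by
  \<open>(f \<otimes> g) \<circ> Q\<close>.  The final step joins a contraction of the first \<open>i\<close> copies with one of the
  remaining \<open>k-i\<close>, and the two may be interleaved in \<open>(k-2 choose i-1)\<close> ways.  This gives
  \<open>(k-1)! \<sigma>\<^sup>k = (k-2)! \<Sum>\<^sub>i (\<sigma>\<^sup>i \<otimes> \<sigma>\<^sup>k\<^sup>-\<^sup>i) \<circ> Q\<close>.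

  The sums may be taken out of the formal integral only if the integrands are admissible.  The
  contractions are combinations of integrals indexed by binary trees.  The integrand of a tree is
  that of the composition of the \<open>Q\<^sub>i\<close> which treats the nodes in preorder, hence
  admissible, and integrating out all variables but that of the root leaves the integrand needed.
\<close>


section \<open>Linear forms\<close>

lemma lin_form_superset:
  assumes "finite A" "Poly_Mapping.keys t \<subseteq> A"
  shows "lin_form f t = (\<Sum>b\<in>A. Poly_Mapping.lookup t b * f b)"
  unfolding lin_form_def using assms
  by (intro sum.mono_neutral_left) (auto simp: in_keys_iff)

lemma lin_form_add: "lin_form f (s + t) = lin_form f s + lin_form f t"
proof -
  let ?A = "Poly_Mapping.keys s \<union> Poly_Mapping.keys t"
  have "lin_form f r = (\<Sum>b\<in>?A. Poly_Mapping.lookup r b * f b)" if "r \<in> {s, t, s + t}" for r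
    using that keys_add[of s t] by (intro lin_form_superset) auto
  then show ?thesis
    by (simp add: lookup_add sum.distrib distrib_right)
qed

lemma lin_form_single [simp]: "lin_form f (Poly_Mapping.single b c) = c * f b"
  by (subst lin_form_superset[of "{b}"]) auto

lemma lin_form_scale: "lin_form f (scale c t) = c * lin_form f t"
  by (induction t rule: lin_comb_induct) (simp_all add: scale_single scale_add lin_form_add algebra_simps)

lemma lin_form_lin_map: "lin_form f (lin_map F t) = lin_form (\<lambda>b. lin_form f (F b)) t"
  by (induction t rule: lin_comb_induct)
    (simp_all add: lin_map_single lin_map_add lin_form_add lin_form_scale)

lemma lin_form_mult_left: "lin_form (\<lambda>b. c * f b) t = c * lin_form f t"
  by (simp add: lin_form_def sum_distrib_left mult_ac)

lemma lin_form_add_fun: "lin_form (\<lambda>b. f b + g b) t = lin_form f t + lin_form g t"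
  by (simp add: lin_form_def sum.distrib distrib_left)

lemma linear_scale_iff:
  "Vector_Spaces.linear scale (*) f \<longleftrightarrow>
    (\<forall>a b. f (a + b) = f a + f b) \<and> (\<forall>c a. f (scale c a) = c * f a)"
proof -
  have "vector_space ((*) :: complex \<Rightarrow> complex \<Rightarrow> complex)"
    by unfold_locales (simp_all add: algebra_simps)
  then show ?thesis
    by (simp add: Vector_Spaces.linear_iff vector_space_scale)
qed

text \<open>Pulling back to single monomials leaves a form given by its values on the basis; this
  recovers the form itself.\<close>

lemma linear_conv_lin_form:
  assumes "Vector_Spaces.linear scale (*) f"
  shows "lin_form (\<lambda>b. f (basis b)) a = f a"
proof (induction a rule: lin_comb_induct)
  case (single b c)
  have "f (scale c (basis b)) = c * f (basis b)"
    using assms by (simp only: linear_scale_iff)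
  then show ?case
    by (simp add: scale_single)
qed (use assms in \<open>simp add: linear_scale_iff lin_form_add\<close>)

lemma form_tensor2_add: "form_tensor2 f g (s + t) = form_tensor2 f g s + form_tensor2 f g t"
  by (simp add: form_tensor2_def lin_form_add)

lemma form_tensor2_scale: "form_tensor2 f g (scale c t) = c * form_tensor2 f g t"
  by (simp add: form_tensor2_def lin_form_scale)

lemma form_tensor2_mult_left: "form_tensor2 (\<lambda>a. c * f a) g t = c * form_tensor2 f g t"
  by (simp add: form_tensor2_def case_prod_unfold mult.assoc lin_form_mult_left)

lemma form_tensor2_mult_right: "form_tensor2 f (\<lambda>a. c * g a) t = c * form_tensor2 f g t"
  by (simp add: form_tensor2_def case_prod_unfold mult.left_commute[of _ c] lin_form_mult_left)

lemma form_tensor2_add_left: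
  "form_tensor2 (\<lambda>a. f a + f' a) g t = form_tensor2 f g t + form_tensor2 f' g t"
  by (simp add: form_tensor2_def case_prod_unfold distrib_right lin_form_add_fun)

lemma form_tensor2_add_right:
  "form_tensor2 f (\<lambda>a. g a + g' a) t = form_tensor2 f g t + form_tensor2 f g' t"
  by (simp add: form_tensor2_def case_prod_unfold distrib_left lin_form_add_fun)


section \<open>Pulling forms back along the insertions of \<open>Q\<close>\<close>

text \<open>Twice the integrand of \<open>Q\<close> at a fixed label pair, hence an ordinary tensor
  and not a formal one.\<close>

definition R_coprod :: "'x sym \<Rightarrow> 'x \<times> 'x \<Rightarrow> 'x sym2" where
  "R_coprod a p = tensor2 (phi (fst p)) (phi (snd p)) * coprod a"

lemma Q_conv_R_coprod: "Q K a \<omega> = (1 / 2) * K (\<lambda>p. \<omega> (R_coprod a p))"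
  by (simp add: Q_def mult_R_def R_def R_coprod_def case_prod_unfold)

lemma R_coprod_add: "R_coprod (a + b) p = R_coprod a p + R_coprod b p"
  by (simp add: R_coprod_def coprod_add distrib_left)

lemma R_coprod_scale: "R_coprod (scale c a) p = scale c (R_coprod a p)"
  by (simp add: R_coprod_def coprod_scale) (simp add: scale_conv_mult mult.left_commute)

text \<open>The transpose of \<open>Q_i\<close> on functions of monomial lists. Compositions of
  formal operators thus become compositions of ordinary functions.\<close>

definition pull :: "'x kernel \<Rightarrow> nat \<Rightarrow> ('x multiset list \<Rightarrow> complex) \<Rightarrow> 'x multiset list \<Rightarrow> complex"
  where "pull K i f u = Q_basis K i u (lin_form f)"

lemma Q_at_lin_form: "Q_at K i \<Psi> (lin_form f) = \<Psi> (lin_form (pull K i f))"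
  by (simp add: Q_at_def pull_def[abs_def])

lemma lin_form_tensor_basis:
  "lin_form f (tensor (basis us) (tensor (tens_of_sym2 t) (basis vs))) =
    lin_form (\<lambda>(m, n). f (us @ m # n # vs)) t"
  by (simp add: tensor_def tens_of_sym2_def lin_form_lin_map lin_map_single lin_form_scale
      case_prod_unfold)

lemma pull_append:
  assumes "i = Suc (length us)"
  shows "pull K i f (us @ m # vs) = Q K (basis m) (lin_form (\<lambda>(m, n). f (us @ m # n # vs)))"
  using assms by (simp add: pull_def Q_basis_def lin_form_tensor_basis)

lemma split_list_at:
  assumes "i \<in> {1..length u}"
  obtains us m vs where "u = us @ m # vs" "i = Suc (length us)"
proof
  show "u = take (i - 1) u @ u ! (i - 1) # drop i u"
    using assms id_take_nth_drop[of "i - 1" u] by (cases i) auto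
  show "i = Suc (length (take (i - 1) u))"
    using assms by auto
qed

text \<open>Agreement of two functions is only required on lists of the right length, because
  \<^const>\<open>Q_basis\<close> takes junk values when its position argument exceeds the length of the list.\<close>

definition agree :: "nat \<Rightarrow> ('b list \<Rightarrow> complex) \<Rightarrow> ('b list \<Rightarrow> complex) \<Rightarrow> bool" where
  "agree n f g \<longleftrightarrow> (\<forall>u. length u = n \<longrightarrow> f u = g u)"

lemma agree_trans: "agree n f g \<Longrightarrow> agree n g h \<Longrightarrow> agree n f h"
  by (simp add: agree_def)

text \<open>An insertion of \<open>Q\<close> turns a list of length \<open>n\<close> into lists of
  length \<open>n + 1\<close>, and only the values there enter.\<close>

lemma pull_cong:
  assumes "agree (Suc n) f g" "i \<in> {1..n}"
  shows "agree n (pull K i f) (pull K i g)"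
  unfolding agree_def
proof (intro allI impI)
  fix u :: "'a multiset list"
  assume u: "length u = n"
  then obtain us m vs where *: "u = us @ m # vs" "i = Suc (length us)"
    using assms(2) split_list_at by metis
  have "f (us @ m # n # vs) = g (us @ m # n # vs)" for m n
    using assms(1) u * by (simp add: agree_def)
  then show "pull K i f u = pull K i g u"
    by (simp add: * pull_append)
qed

text \<open>\<open>Lambda K n\<close> takes values in the tensor power with \<open>n + 1\<close>
  factors, so a form may be replaced by one that differs from it at other lengths.\<close>

lemma Lambda_cong:
  assumes "agree (Suc n) f g"
  shows "Lambda K n a (lin_form f) = Lambda K n a (lin_form g)"
  using assms
proof (induction n arbitrary: f g)
  case 0
  then show ?case
    by (simp add: tens_of_sym_def lin_form_lin_map agree_def)
next
  case (Suc n)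
  then have "Lambda K n a (lin_form (pull K i f)) = Lambda K n a (lin_form (pull K i g))"
    if "i \<in> {1..Suc n}" for i
    using that by (intro Suc.IH pull_cong)
  then show ?case
    by (simp add: Q_at_lin_form)
qed

text \<open>The tensor product of the listed forms. On lists of another length the value is junk,
  which \<open>agree\<close> hides.\<close>

fun product :: "('x sym \<Rightarrow> complex) list \<Rightarrow> 'x multiset list \<Rightarrow> complex" where
  "product (f # fs) (m # u) = f (basis m) * product fs u"
| "product _ _ = 1"

lemma product_append:
  "length fs = length u \<Longrightarrow> product (fs @ gs) (u @ v) = product fs u * product gs v"
  by (induction fs u rule: list_induct2) simp_all

lemma form_power_agree:
  "agree k (\<lambda>u. if length u = k then \<Prod>m\<leftarrow>u. f (basis m) else 0) (product (replicate k f))"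
proof -
  have "(\<Prod>m\<leftarrow>u. f (basis m)) = product (replicate (length u) f) u" for u
    by (induction u) simp_all
  then show ?thesis
    by (simp add: agree_def)
qed

text \<open>\<open>Q\<close> touches a single factor, so the values of the other forms are a scalar
  under the integral, and \<open>hom\<close> takes it out. For an evaluation kernel
  \<open>hom\<close> is trivial; for a formal integral it comes from admissibility.\<close>

lemma pull_product:
  assumes "i = Suc (length xs)"
    and hom: "\<And>m c. K (\<lambda>p. c * form_tensor2 f g (R_coprod (basis m) p)) =
      c * K (\<lambda>p. form_tensor2 f g (R_coprod (basis m) p))"
  shows "agree (Suc (length xs + length ys)) (pull K i (product (xs @ f # g # ys)))
    (product (xs @ (\<lambda>a. Q K a (form_tensor2 f g)) # ys))"
  unfolding agree_def
proof (intro allI impI)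
  fix u :: "'a multiset list"
  assume u: "length u = Suc (length xs + length ys)"
  obtain us m vs where *: "u = us @ m # vs" "i = Suc (length us)"
    by (rule split_list_at[of i u]) (use assms(1) u in auto)
  have len: "length xs = length us"
    using * assms(1) by simp
  have "lin_form (\<lambda>(m, n). product (xs @ f # g # ys) (us @ m # n # vs)) t =
      (product xs us * product ys vs) * form_tensor2 f g t" for t
    unfolding form_tensor2_def
    by (subst lin_form_mult_left[symmetric]) (simp add: len product_append case_prod_unfold mult_ac)
  then have "pull K i (product (xs @ f # g # ys)) u =
      1 / 2 * K (\<lambda>p. (product xs us * product ys vs) * form_tensor2 f g (R_coprod (basis m) p))"
    using *(2) by (simp only: *(1) pull_append Q_conv_R_coprod)
  then show "pull K i (product (xs @ f # g # ys)) u =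
      product (xs @ (\<lambda>a. Q K a (form_tensor2 f g)) # ys) u"
    using len by (simp only: hom) (simp add: * product_append Q_conv_R_coprod mult_ac)
qed


section \<open>Integrands indexed by binary trees\<close>

text \<open>Leaves stand for copies of \<open>\<tau>\<close>, inner nodes for applications of
  \<open>Q\<close>.\<close>

datatype tree = Leaf | Node tree tree

text \<open>Only inner nodes count, so \<open>T\<close> has \<open>nodes T + 1\<close>
  leaves.\<close>

primrec nodes :: "tree \<Rightarrow> nat" where
  "nodes Leaf = 0"
| "nodes (Node l r) = Suc (nodes l + nodes r)"

lemma upt_nodes_Node:
  "[s..<s + nodes (Node l r)] =
    s # [Suc s..<Suc s + nodes l] @ [Suc (s + nodes l)..<Suc (s + nodes l) + nodes r]"
proof -
  have "[s..<s + nodes (Node l r)] = s # [Suc s..<Suc s + nodes l + nodes r]"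
    by (subst upt_conv_Cons) (simp_all add: add.assoc del: upt_Suc)
  moreover have "[Suc s..<Suc s + nodes l + nodes r] =
      [Suc s..<Suc s + nodes l] @ [Suc s + nodes l..<Suc s + nodes l + nodes r]"
    by (rule upt_add_eq_append) simp
  ultimately show ?thesis
    by (simp only: add_Suc)
qed

text \<open>The node number \<open>j\<close> of the tree in preorder uses the label pair \<open>\<rho> (s + j)\<close>.\<close>

primrec integrand :: "('x sym \<Rightarrow> complex) \<Rightarrow> tree \<Rightarrow> nat \<Rightarrow> (nat \<Rightarrow> 'x \<times> 'x) \<Rightarrow> 'x sym \<Rightarrow> complex"
  where
  "integrand \<tau> Leaf s \<rho> = \<tau>"
| "integrand \<tau> (Node l r) s \<rho> = (\<lambda>a. Q (\<lambda>f. f (\<rho> s)) a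
     (form_tensor2 (integrand \<tau> l (Suc s) \<rho>) (integrand \<tau> r (Suc (s + nodes l)) \<rho>)))"

text \<open>Here every node is integrated on the spot, whereas \<open>integrand\<close> keeps all
  label pairs free.\<close>

primrec tree_integral :: "'x kernel \<Rightarrow> ('x sym \<Rightarrow> complex) \<Rightarrow> tree \<Rightarrow> 'x sym \<Rightarrow> complex" where
  "tree_integral K \<tau> Leaf = \<tau>"
| "tree_integral K \<tau> (Node l r) =
     (\<lambda>a. Q K a (form_tensor2 (tree_integral K \<tau> l) (tree_integral K \<tau> r)))"

text \<open>The positions of successive insertions. The left subtree grows at the position of its
  root; once it occupies \<open>nodes l + 1\<close> factors, the right one starts at
  \<open>i + nodes l + 1\<close>.\<close>

primrec preorder :: "tree \<Rightarrow> nat \<Rightarrow> nat list" where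
  "preorder Leaf i = []"
| "preorder (Node l r) i = i # preorder l i @ preorder r (Suc (i + nodes l))"

lemma length_preorder [simp]: "length (preorder T i) = nodes T"
  by (induction T arbitrary: i) simp_all

text \<open>Each insertion adds one factor. For \<open>i = 1\<close> this is the range of positions
  that \<open>integrals_exist\<close> demands.\<close>

lemma preorder_bounds: "j < nodes T \<Longrightarrow> preorder T i ! j \<in> {i..i + j}"
proof (induction T arbitrary: i j)
  case (Node l r)
  consider "j = 0" | k where "j = Suc k" "k < nodes l" | k where "j = Suc k" "nodes l \<le> k"
    by (cases j) (auto, meson not_less)
  then show ?case
  proof cases
    case 2
    then show ?thesis
      using Node.IH(1)[of k i] by (auto simp: nth_append)
  next
    case 3
    then have "k - nodes l < nodes r"
      using Node.prems by auto
    with 3 show ?thesis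
      using Node.IH(2)[of "k - nodes l" "Suc (i + nodes l)"] Node.prems by (auto simp: nth_append)
  qed simp
qed simp

text \<open>Only the block of \<open>nodes T\<close> label pairs starting at \<open>s\<close>
  matters. This permits renaming the pairs and changing those outside the block.\<close>

lemma integrand_cong:
  "(\<And>j. j < nodes T \<Longrightarrow> \<rho> (s + j) = \<rho>' (s' + j)) \<Longrightarrow> integrand \<tau> T s \<rho> = integrand \<tau> T s' \<rho>'"
proof (induction T arbitrary: s s')
  case (Node l r)
  have "integrand \<tau> l (Suc s) \<rho> = integrand \<tau> l (Suc s') \<rho>'"
    using Node.prems[of "Suc _"] by (intro Node.IH) simp
  moreover have "integrand \<tau> r (Suc (s + nodes l)) \<rho> = integrand \<tau> r (Suc (s' + nodes l)) \<rho>'"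
    using Node.prems[of "Suc (nodes l + _)"] by (intro Node.IH) (simp add: add.assoc)
  ultimately show ?case
    using Node.prems[of 0] by simp
qed simp

section \<open>Words of insertions and their pullbacks\<close>

abbreviation pulls :: "('x kernel \<times> nat) list \<Rightarrow> ('x multiset list \<Rightarrow> complex) \<Rightarrow>
    'x multiset list \<Rightarrow> complex" where
  "pulls ops f \<equiv> foldr (\<lambda>(K, i). pull K i) ops f"

text \<open>Transposing reverses the order: the insertion made first is pulled back last, which
  \<open>foldr\<close> achieves on the list in its original order.\<close>

lemma Q_word_lin_form:
  "Q_word Ks w n a (lin_form f) =
    lin_form (\<lambda>m. pulls (zip (map Ks [0..<n]) (map w [0..<n])) f [m]) a"
proof (induction n arbitrary: f)
  case 0
  show ?case
    by (simp add: tens_of_sym_def lin_form_lin_map)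
next
  case (Suc n)
  then show ?case
    by (simp add: Q_at_lin_form)
qed

lemma pulls_cong:
  assumes "agree (n + length w) f g" "\<And>j. j < length w \<Longrightarrow> w ! j \<in> {1..n + j}"
    and "length Ks = length w"
  shows "agree n (pulls (zip Ks w) f) (pulls (zip Ks w) g)"
  using assms
proof (induction w arbitrary: n Ks)
  case (Cons i w)
  obtain K Ks' where Ks: "Ks = K # Ks'" "length Ks' = length w"
    using Cons.prems(3) by (cases Ks) auto
  have "agree (Suc n) (pulls (zip Ks' w) f) (pulls (zip Ks' w) g)"
    using Cons.prems(1) Cons.prems(2)[of "Suc _"] Ks(2) by (intro Cons.IH) auto
  then show ?case
    using Cons.prems(2)[of 0] by (simp add: Ks pull_cong)
qed simp

text \<open>Read backwards, the word first contracts the leaves of the right subtree, then those of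
  the left one, and finally joins the two results at the root. The surrounding factors
  \<open>xs\<close> and \<open>ys\<close> are general because a subtree has its siblings beside
  it.\<close>

lemma pulls_preorder:
  assumes "i = Suc (length xs)"
  shows "agree (Suc (length xs + length ys))
    (pulls (zip (map (\<lambda>j f. f (\<rho> j)) [s..<s + nodes T]) (preorder T i))
      (product (xs @ replicate (Suc (nodes T)) \<tau> @ ys)))
    (product (xs @ integrand \<tau> T s \<rho> # ys))"
  using assms
proof (induction T arbitrary: i xs ys s)
  case Leaf
  show ?case
    by (simp add: agree_def)
next
  case (Node l r)
  let ?ops = "\<lambda>T s i. zip (map (\<lambda>j f. f (\<rho> j)) [s..<s + nodes T]) (preorder T i)"
  let ?L = "integrand \<tau> l (Suc s) \<rho>" and ?R = "integrand \<tau> r (Suc (s + nodes l)) \<rho>"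
  let ?rep = "\<lambda>T. replicate (Suc (nodes T)) \<tau>"
  let ?N = "length xs + length ys"
  have ops: "?ops (Node l r) s i =
      (\<lambda>f. f (\<rho> s), i) # ?ops l (Suc s) i @ ?ops r (Suc (s + nodes l)) (Suc (i + nodes l))"
  proof -
    have "[s..<s + nodes (Node l r)] =
        s # [Suc s..<Suc s + nodes l] @ [Suc (s + nodes l)..<Suc (s + nodes l) + nodes r]"
      using upt_nodes_Node[of s l r] .
    then show ?thesis
      by simp
  qed
  have rep: "replicate (Suc (nodes (Node l r))) \<tau> = ?rep l @ ?rep r"
    by (simp add: replicate_add[symmetric] replicate_app_Cons_same)
  \<comment> \<open>While the right subtree is contracted, the \<open>nodes l + 1\<close> leaves of
    the left one still stand before it.\<close>
  have "agree (Suc (length (xs @ ?rep l) + length ys))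
      (pulls (?ops r (Suc (s + nodes l)) (Suc (i + nodes l))) (product ((xs @ ?rep l) @ ?rep r @ ys)))
      (product ((xs @ ?rep l) @ ?R # ys))"
    using Node.prems by (intro Node.IH) simp
  from this[unfolded append_assoc] have "agree (Suc (Suc ?N))
      (pulls (?ops l (Suc s) i) (pulls (?ops r (Suc (s + nodes l)) (Suc (i + nodes l)))
        (product (xs @ ?rep l @ ?rep r @ ys))))
      (pulls (?ops l (Suc s) i) (product (xs @ ?rep l @ ?R # ys)))"
  proof (intro pulls_cong)
    fix j assume "j < length (preorder l i)"
    then show "preorder l i ! j \<in> {1..Suc (Suc ?N) + j}"
      using preorder_bounds[of j l i] Node.prems by auto
  qed (simp_all add: add_ac)
  moreover have "agree (Suc (Suc ?N))
      (pulls (?ops l (Suc s) i) (product (xs @ ?rep l @ ?R # ys))) (product (xs @ ?L # ?R # ys))"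
    using Node.IH(1)[OF Node.prems, where ys = "?R # ys" and s = "Suc s"]
    by (simp only: length_Cons add_Suc_right)
  ultimately have "agree (Suc (Suc ?N))
      (pulls (?ops l (Suc s) i) (pulls (?ops r (Suc (s + nodes l)) (Suc (i + nodes l)))
        (product (xs @ ?rep l @ ?rep r @ ys))))
      (product (xs @ ?L # ?R # ys))"
    by (rule agree_trans)
  then have "agree (Suc ?N)
      (pulls (?ops (Node l r) s i) (product (xs @ ?rep l @ ?rep r @ ys)))
      (pull (\<lambda>f. f (\<rho> s)) i (product (xs @ ?L # ?R # ys)))"
    unfolding ops using Node.prems by (auto intro!: pull_cong)
  moreover have "agree (Suc ?N) (pull (\<lambda>f. f (\<rho> s)) i (product (xs @ ?L # ?R # ys)))
      (product (xs @ (\<lambda>a. Q (\<lambda>f. f (\<rho> s)) a (form_tensor2 ?L ?R)) # ys))"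
    using Node.prems by (intro pull_product) simp_all
  ultimately show ?case
    unfolding rep append_assoc integrand.simps by (rule agree_trans)
qed


text \<open>A case distinction suffices: \<open>form_tensor2\<close> is linear in the tensor for
  arbitrary forms, and evaluation at a pair is linear.\<close>

lemma integrand_linear:
  assumes "Vector_Spaces.linear scale (*) \<tau>"
  shows "Vector_Spaces.linear scale (*) (integrand \<tau> T s \<rho>)"
  using assms
  by (cases T) (simp_all add: linear_scale_iff Q_conv_R_coprod R_coprod_add R_coprod_scale
      form_tensor2_add form_tensor2_scale add_divide_distrib)

text \<open>This places the integrands of trees among the functions that
  \<open>integrals_exist\<close> declares admissible.\<close>

lemma Q_word_preorder:
  assumes "Vector_Spaces.linear scale (*) \<tau>"
  shows "Q_word (\<lambda>j f. f (\<rho> j)) (nth (preorder T 1)) (nodes T) a (form_power (Suc (nodes T)) \<tau>) =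
    integrand \<tau> T 0 \<rho> a"
proof -
  let ?g = "\<lambda>u. if length u = Suc (nodes T) then \<Prod>m\<leftarrow>u. \<tau> (basis m) else 0"
  let ?ops = "zip (map (\<lambda>j f. f (\<rho> j)) [0..<nodes T]) (preorder T 1)"
  have "agree (Suc 0) (pulls ?ops ?g) (pulls ?ops (product (replicate (Suc (nodes T)) \<tau>)))"
    using form_power_agree[of "Suc (nodes T)" \<tau>] preorder_bounds[of _ T 1]
    by (intro pulls_cong) simp_all
  moreover have "agree (Suc 0) (pulls ?ops (product (replicate (Suc (nodes T)) \<tau>)))
      (product [integrand \<tau> T 0 \<rho>])"
    using pulls_preorder[of 1 "[]" "[]" \<rho> 0 T \<tau>] by simp
  ultimately have "agree (Suc 0) (pulls ?ops ?g) (product [integrand \<tau> T 0 \<rho>])"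
    by (rule agree_trans)
  then have "pulls ?ops ?g [m] = integrand \<tau> T 0 \<rho> (basis m)" for m
    by (simp add: agree_def)
  moreover have "map (nth (preorder T 1)) [0..<nodes T] = preorder T 1"
    using map_nth[of "preorder T 1"] by simp
  ultimately show ?thesis
    by (simp add: form_power_def Q_word_lin_form linear_conv_lin_form[OF integrand_linear[OF assms]])
qed


section \<open>Admissibility\<close>

context feynman_kernel
begin

lemma adm_sum:
  assumes "finite A" "\<And>b. b \<in> A \<Longrightarrow> f b \<in> adm"
  shows "(\<lambda>\<rho>. \<Sum>b\<in>A. c b * f b \<rho>) \<in> adm"
  using assms by (induction A rule: finite_induct) (simp_all add: adm_zero adm_add adm_mult)

lemma integral_sum:
  assumes "finite A" "\<And>b. b \<in> A \<Longrightarrow> f b \<in> adm"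
  shows "K (\<lambda>p. \<Sum>b\<in>A. c b * f b (\<rho>(i := p))) = (\<Sum>b\<in>A. c b * K (\<lambda>p. f b (\<rho>(i := p))))"
  using assms
proof (induction A rule: finite_induct)
  case empty
  show ?case
    using integral_mult[OF adm_zero, of 0] by simp
next
  case (insert b A)
  have "K (\<lambda>p. c b * f b (\<rho>(i := p)) + (\<Sum>b\<in>A. c b * f b (\<rho>(i := p)))) =
      K (\<lambda>p. c b * f b (\<rho>(i := p))) + K (\<lambda>p. \<Sum>b\<in>A. c b * f b (\<rho>(i := p)))"
    using insert by (intro integral_add[of "\<lambda>\<rho>. c b * f b \<rho>"] adm_mult adm_sum) simp_all
  also have "K (\<lambda>p. c b * f b (\<rho>(i := p))) = c b * K (\<lambda>p. f b (\<rho>(i := p)))"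
    using insert.prems by (intro integral_mult) simp
  also have "K (\<lambda>p. \<Sum>b\<in>A. c b * f b (\<rho>(i := p))) = (\<Sum>b\<in>A. c b * K (\<lambda>p. f b (\<rho>(i := p))))"
    using insert.prems by (intro insert.IH) simp
  finally show ?case
    by (simp only: sum.insert[OF insert.hyps])
qed

text \<open>Iterated integration, with the first index outermost. The result is again a function of
  \<open>\<rho>\<close>, so admissibility can be carried through every stage.\<close>

primrec integrals :: "nat list \<Rightarrow> ((nat \<Rightarrow> 'x \<times> 'x) \<Rightarrow> complex) \<Rightarrow> (nat \<Rightarrow> 'x \<times> 'x) \<Rightarrow> complex" where
  "integrals [] f = f"
| "integrals (i # is) f = (\<lambda>\<rho>. K (\<lambda>p. integrals is f (\<rho>(i := p))))"

lemma integrals_append: "integrals (is @ js) f = integrals is (integrals js f)"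
  by (induction "is") simp_all

lemma integrals_adm: "f \<in> adm \<Longrightarrow> integrals is f \<in> adm"
  by (induction "is") (simp_all add: adm_integral)

text \<open>For fixed \<open>\<rho>\<close> the form is a finite linear combination whose
  coefficients do not involve the integrated pairs, so linearity applies to each integral in
  turn.\<close>

lemma integrals_lin_form:
  assumes h: "\<And>b. h b \<in> adm"
    and v: "\<And>\<rho> i p. i \<in> set is \<Longrightarrow> v (\<rho>(i := p)) = v \<rho>"
    and c: "\<And>\<rho> i p b. i \<in> set is \<Longrightarrow> c b (\<rho>(i := p)) = c b \<rho>"
  shows "integrals is (\<lambda>\<rho>. lin_form (\<lambda>b. c b \<rho> * h b \<rho>) (v \<rho>)) \<rho> =
    lin_form (\<lambda>b. c b \<rho> * integrals is (h b) \<rho>) (v \<rho>)"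
  using v c
proof (induction "is" arbitrary: \<rho>)
  case (Cons i "is")
  have v: "v (\<rho>(i := p)) = v \<rho>" and c: "c b (\<rho>(i := p)) = c b \<rho>" for p b
    by (rule Cons.prems, simp)+
  \<comment> \<open>The coefficients are rewritten at the updated \<open>\<rho>\<close>, where the
    induction hypothesis applies.\<close>
  have step: "integrals is (\<lambda>\<rho>. lin_form (\<lambda>b. c b \<rho> * h b \<rho>) (v \<rho>)) (\<rho>(i := p)) =
      lin_form (\<lambda>b. c b \<rho> * integrals is (h b) (\<rho>(i := p))) (v \<rho>)" for p
    unfolding c[of _ p, symmetric] v[of p, symmetric]
    by (rule Cons.IH) (rule Cons.prems, simp)+
  have "K (\<lambda>p. \<Sum>b\<in>Poly_Mapping.keys (v \<rho>).
        (Poly_Mapping.lookup (v \<rho>) b * c b \<rho>) * integrals is (h b) (\<rho>(i := p))) =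
      (\<Sum>b\<in>Poly_Mapping.keys (v \<rho>).
        (Poly_Mapping.lookup (v \<rho>) b * c b \<rho>) * K (\<lambda>p. integrals is (h b) (\<rho>(i := p))))"
    by (intro integral_sum) (simp_all add: integrals_adm h)
  then show ?case
    by (simp only: integrals.simps step) (simp only: lin_form_def mult.assoc)
qed simp

end

locale feynman_form = feynman_kernel adm K G
  for adm :: "((nat \<Rightarrow> 'x \<times> 'x) \<Rightarrow> complex) set" and K :: "'x kernel" and G +
  fixes \<tau> :: "'x sym \<Rightarrow> complex"
  assumes linear: "Vector_Spaces.linear scale (*) \<tau>"
    and integrals_exist: "integrals_exist adm \<tau>"
begin

lemma integrand_adm: "(\<lambda>\<rho>. integrand \<tau> T s \<rho> a) \<in> adm"
proof -
  have "\<forall>j<nodes T. preorder T 1 ! j \<in> {1..Suc j}"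
    using preorder_bounds[of _ T 1] by simp
  then have "(\<lambda>\<rho>. Q_word (\<lambda>j f. f (\<rho> j)) (nth (preorder T 1)) (nodes T) a
      (form_power (Suc (nodes T)) \<tau>)) \<in> adm"
    using integrals_exist unfolding integrals_exist_def by blast
  then have adm0: "(\<lambda>\<rho>. integrand \<tau> T 0 \<rho> a) \<in> adm"
    by (simp only: Q_word_preorder[OF linear])
  \<comment> \<open>\<open>adm_rename\<close> asks for a bijection, so a shift by \<open>s\<close>
    will not do: \<open>\<pi>\<close> exchanges the first \<open>nodes T\<close> indices with the
    \<open>s\<close> indices after them.\<close>
  define \<pi> where
    "\<pi> j = (if j < nodes T then j + s else if j < nodes T + s then j - nodes T else j)" for j
  define \<pi>' where "\<pi>' k = (if k < s then k + nodes T else if k < s + nodes T then k - s else k)" for k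
  have "bij \<pi>"
    by (rule o_bij[of \<pi>']) (auto simp: fun_eq_iff \<pi>_def \<pi>'_def)
  then have "(\<lambda>\<rho>. integrand \<tau> T 0 (\<rho> \<circ> \<pi>) a) \<in> adm"
    using adm_rename[OF adm0] by simp
  moreover have "integrand \<tau> T 0 (\<rho> \<circ> \<pi>) = integrand \<tau> T s \<rho>" for \<rho>
    by (rule integrand_cong) (simp add: \<pi>_def add.commute)
  ultimately show ?thesis
    by simp
qed

text \<open>The two subtrees use disjoint blocks of pairs. The right block is integrated first, with
  the left integrand as coefficient; then the left block, with the right integral as a constant. The
  root pair stays free.\<close>

lemma integrals_integrand_children:
  assumes l: "\<And>s \<rho> a. integrals [s..<s + nodes l] (\<lambda>\<rho>. integrand \<tau> l s \<rho> a) \<rho> = tree_integral K \<tau> l a"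
    and r: "\<And>s \<rho> a. integrals [s..<s + nodes r] (\<lambda>\<rho>. integrand \<tau> r s \<rho> a) \<rho> = tree_integral K \<tau> r a"
  shows "integrals ([Suc s..<Suc s + nodes l] @ [Suc (s + nodes l)..<Suc (s + nodes l) + nodes r])
      (\<lambda>\<rho>. integrand \<tau> (Node l r) s \<rho> a) \<rho> =
    1 / 2 * form_tensor2 (tree_integral K \<tau> l) (tree_integral K \<tau> r) (R_coprod a (\<rho> s))"
proof -
  let ?is = "[Suc s..<Suc s + nodes l]" and ?js = "[Suc (s + nodes l)..<Suc (s + nodes l) + nodes r]"
  define v where "v \<rho> = scale (1 / 2) (R_coprod a (\<rho> s))" for \<rho> :: "nat \<Rightarrow> 'x \<times> 'x"
  let ?l = "\<lambda>b \<rho>. integrand \<tau> l (Suc s) \<rho> (basis (fst b))"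
  let ?r = "\<lambda>b \<rho>. integrand \<tau> r (Suc (s + nodes l)) \<rho> (basis (snd b))"
  have v: "v (\<rho>(i := p)) = v \<rho>" if "i > s" for \<rho> i p
    using that by (simp add: v_def)
  have "integrals ?js (\<lambda>\<rho>. integrand \<tau> (Node l r) s \<rho> a) \<rho> =
      lin_form (\<lambda>b. tree_integral K \<tau> r (basis (snd b)) * ?l b \<rho>) (v \<rho>)" for \<rho>
  proof -
    have "integrals ?js (\<lambda>\<rho>. lin_form (\<lambda>b. ?l b \<rho> * ?r b \<rho>) (v \<rho>)) \<rho> =
        lin_form (\<lambda>b. ?l b \<rho> * integrals ?js (?r b) \<rho>) (v \<rho>)"
    proof (rule integrals_lin_form)
      fix \<rho> :: "nat \<Rightarrow> 'x \<times> 'x" and i p and b :: "'x multiset \<times> 'x multiset"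
      assume i: "i \<in> set ?js"
      then show "v (\<rho>(i := p)) = v \<rho>"
        by (intro v) auto
      have "integrand \<tau> l (Suc s) (\<rho>(i := p)) = integrand \<tau> l (Suc s) \<rho>"
        using i by (intro integrand_cong) auto
      then show "?l b (\<rho>(i := p)) = ?l b \<rho>"
        by simp
    qed (rule integrand_adm)
    then show ?thesis
      unfolding r
      by (simp add: Q_conv_R_coprod form_tensor2_def v_def lin_form_scale case_prod_unfold mult.commute)
  qed
  then have "integrals (?is @ ?js) (\<lambda>\<rho>. integrand \<tau> (Node l r) s \<rho> a) \<rho> =
      integrals ?is (\<lambda>\<rho>. lin_form (\<lambda>b. tree_integral K \<tau> r (basis (snd b)) * ?l b \<rho>) (v \<rho>)) \<rho>"
    unfolding integrals_append by presburger
  also have "\<dots> = lin_form (\<lambda>b. tree_integral K \<tau> r (basis (snd b)) * integrals ?is (?l b) \<rho>) (v \<rho>)"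
    by (rule integrals_lin_form) (auto simp: v integrand_adm)
  also have "\<dots> = 1 / 2 * form_tensor2 (tree_integral K \<tau> l) (tree_integral K \<tau> r) (R_coprod a (\<rho> s))"
    unfolding l by (simp add: form_tensor2_def v_def lin_form_scale case_prod_unfold mult.commute)
  finally show ?thesis .
qed

lemma integrals_integrand:
  "integrals [s..<s + nodes T] (\<lambda>\<rho>. integrand \<tau> T s \<rho> a) \<rho> = tree_integral K \<tau> T a"
proof (induction T arbitrary: s \<rho> a)
  case (Node l r)
  let ?f = "\<lambda>\<rho>. form_tensor2 (tree_integral K \<tau> l) (tree_integral K \<tau> r) (R_coprod a (\<rho> s))"
  let ?is = "[Suc s..<Suc s + nodes l] @ [Suc (s + nodes l)..<Suc (s + nodes l) + nodes r]"
  have inner: "integrals ?is (\<lambda>\<rho>. integrand \<tau> (Node l r) s \<rho> a) = (\<lambda>\<rho>. 1 / 2 * ?f \<rho>)"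
    by (rule ext) (rule integrals_integrand_children[OF Node.IH])
  \<comment> \<open>The root integrand is an iterated integral of an admissible function, hence
    admissible; multiplying by 2 then clears the factor of \<open>Q\<close>.\<close>
  then have "(\<lambda>\<rho>. 1 / 2 * ?f \<rho>) \<in> adm"
    using integrals_adm[OF integrand_adm] by metis
  from adm_mult[OF this, of 2] have "?f \<in> adm"
    by simp
  then have "K (\<lambda>p. 1 / 2 * ?f (\<rho>(s := p))) = 1 / 2 * K (\<lambda>p. ?f (\<rho>(s := p)))"
    by (rule integral_mult)
  moreover have "integrals [s..<s + nodes (Node l r)] (\<lambda>\<rho>. integrand \<tau> (Node l r) s \<rho> a) \<rho> =
      K (\<lambda>p. integrals ?is (\<lambda>\<rho>. integrand \<tau> (Node l r) s \<rho> a) (\<rho>(s := p)))"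
    unfolding upt_nodes_Node by (simp only: integrals.simps)
  ultimately show ?case
    unfolding inner by (simp add: Q_conv_R_coprod)
qed simp

lemma tree_integral_adm:
  "(\<lambda>\<rho>. form_tensor2 (tree_integral K \<tau> l) (tree_integral K \<tau> r) (R_coprod a (\<rho> s))) \<in> adm"
    (is "?f \<in> adm")
proof -
  have "(\<lambda>\<rho>. 1 / 2 * ?f \<rho>) \<in> adm"
    unfolding integrals_integrand_children[OF integrals_integrand integrals_integrand, symmetric]
    by (rule integrals_adm[OF integrand_adm])
  from adm_mult[OF this, of 2] show ?thesis
    by simp
qed


section \<open>The span of the tree integrals\<close>

text \<open>The forms met during contraction are sums of trees. On this space the integrals formed
  by \<open>Q\<close> have admissible integrands.\<close>

inductive_set tree_span :: "('x sym \<Rightarrow> complex) set" where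
  tree: "tree_integral K \<tau> T \<in> tree_span"
| add: "f \<in> tree_span \<Longrightarrow> g \<in> tree_span \<Longrightarrow> (\<lambda>a. f a + g a) \<in> tree_span"
| mult: "f \<in> tree_span \<Longrightarrow> (\<lambda>a. c * f a) \<in> tree_span"

lemma tree_span_tau: "\<tau> \<in> tree_span"
  using tree[of Leaf] by simp

lemma tree_span_zero: "(\<lambda>a. 0) \<in> tree_span"
  using mult[OF tree_span_tau, of 0] by simp

lemma tree_span_sum: "(\<And>i. i \<in> A \<Longrightarrow> f i \<in> tree_span) \<Longrightarrow> (\<lambda>a. \<Sum>i\<in>A. f i a) \<in> tree_span"
  by (induction A rule: infinite_finite_induct) (simp_all add: tree_span_zero add)

text \<open>Bilinearity of \<open>form_tensor2\<close> in the two forms reduces the claim to a pair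
  of trees.\<close>

lemma tree_span_adm:
  assumes "f \<in> tree_span" "g \<in> tree_span"
  shows "(\<lambda>\<rho>. form_tensor2 f g (R_coprod a (\<rho> s))) \<in> adm"
  using assms
proof (induction f)
  case (tree l)
  then show ?case
    by induction (simp_all add: tree_integral_adm form_tensor2_add_right form_tensor2_mult_right
        adm_add adm_mult)
qed (simp_all add: form_tensor2_add_left form_tensor2_mult_left adm_add adm_mult)

lemma tree_span_integral_mult:
  assumes "f \<in> tree_span" "g \<in> tree_span"
  shows "K (\<lambda>p. c * form_tensor2 f g (R_coprod a p)) = c * K (\<lambda>p. form_tensor2 f g (R_coprod a p))"
  using integral_mult[OF tree_span_adm[OF assms, of a 0], of c _ 0] by simp

lemma tree_span_integral_add:
  assumes "f \<in> tree_span" "g \<in> tree_span" "f' \<in> tree_span" "g' \<in> tree_span"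
  shows "K (\<lambda>p. form_tensor2 f g (R_coprod a p) + form_tensor2 f' g' (R_coprod a' p)) =
    K (\<lambda>p. form_tensor2 f g (R_coprod a p)) + K (\<lambda>p. form_tensor2 f' g' (R_coprod a' p))"
  using integral_add[OF tree_span_adm[OF assms(1,2), of a 0] tree_span_adm[OF assms(3,4), of a' 0], of _ 0]
  by simp

section \<open>Joining two forms through \<open>Q\<close>\<close>

definition merge :: "('x sym \<Rightarrow> complex) \<Rightarrow> ('x sym \<Rightarrow> complex) \<Rightarrow> 'x sym \<Rightarrow> complex" where
  "merge f g = (\<lambda>a. Q K a (form_tensor2 f g))"

text \<open>Additivity is claimed on \<open>tree_span\<close>, where the integral may be
  split.\<close>

lemma merge_add_left:
  assumes "f \<in> tree_span" "f' \<in> tree_span" "g \<in> tree_span"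
  shows "merge (\<lambda>a. f a + f' a) g a = merge f g a + merge f' g a"
  using assms by (simp add: merge_def Q_conv_R_coprod form_tensor2_add_left tree_span_integral_add
      add_divide_distrib)

lemma merge_add_right:
  assumes "f \<in> tree_span" "g \<in> tree_span" "g' \<in> tree_span"
  shows "merge f (\<lambda>a. g a + g' a) a = merge f g a + merge f g' a"
  using assms by (simp add: merge_def Q_conv_R_coprod form_tensor2_add_right tree_span_integral_add
      add_divide_distrib)

lemma merge_mult_left:
  assumes "f \<in> tree_span" "g \<in> tree_span"
  shows "merge (\<lambda>a. c * f a) g a = c * merge f g a"
  using assms by (simp add: merge_def Q_conv_R_coprod form_tensor2_mult_left tree_span_integral_mult)

lemma merge_mult_right:
  assumes "f \<in> tree_span" "g \<in> tree_span"
  shows "merge f (\<lambda>a. c * g a) a = c * merge f g a"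
  using assms by (simp add: merge_def Q_conv_R_coprod form_tensor2_mult_right tree_span_integral_mult)

lemma merge_sum_left:
  assumes "finite A" "\<And>i. i \<in> A \<Longrightarrow> f i \<in> tree_span" "g \<in> tree_span"
  shows "merge (\<lambda>a. \<Sum>i\<in>A. f i a) g a = (\<Sum>i\<in>A. merge (f i) g a)"
  using assms
proof (induction A rule: finite_induct)
  case empty
  then show ?case
    using merge_mult_left[of "\<lambda>a. 0" g 0 a] by (simp add: tree_span_zero)
qed (simp add: merge_add_left tree_span_sum)

lemma merge_sum_right:
  assumes "finite A" "\<And>i. i \<in> A \<Longrightarrow> g i \<in> tree_span" "f \<in> tree_span"
  shows "merge f (\<lambda>a. \<Sum>i\<in>A. g i a) a = (\<Sum>i\<in>A. merge f (g i) a)"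
  using assms
proof (induction A rule: finite_induct)
  case empty
  then show ?case
    using merge_mult_right[of f "\<lambda>a. 0" 0 a] by (simp add: tree_span_zero)
qed (simp add: merge_add_right tree_span_sum)

text \<open>Two trees merge into the tree having them as children; bilinearity extends this to the
  span.\<close>

lemma merge_tree_span:
  assumes "f \<in> tree_span" "g \<in> tree_span"
  shows "merge f g \<in> tree_span"
  using assms
proof (induction f)
  case (tree l)
  then show ?case
  proof (induction g)
    case (tree r)
    show ?case
      using tree_span.tree[of "Node l r"] by (simp add: merge_def)
  next
    case (add g g')
    then have "merge (tree_integral K \<tau> l) (\<lambda>a. g a + g' a) =
        (\<lambda>a. merge (tree_integral K \<tau> l) g a + merge (tree_integral K \<tau> l) g' a)"
      by (intro ext merge_add_right tree_span.tree)
    then show ?case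
      using add by (simp add: tree_span.add)
  next
    case (mult g c)
    then have "merge (tree_integral K \<tau> l) (\<lambda>a. c * g a) = (\<lambda>a. c * merge (tree_integral K \<tau> l) g a)"
      by (intro ext merge_mult_right tree_span.tree)
    then show ?case
      using mult by (simp add: tree_span.mult)
  qed
next
  case (add f f')
  then have "merge (\<lambda>a. f a + f' a) g = (\<lambda>a. merge f g a + merge f' g a)"
    by (intro ext merge_add_left)
  then show ?case
    using add by (simp add: tree_span.add)
next
  case (mult f c)
  then have "merge (\<lambda>a. c * f a) g = (\<lambda>a. c * merge f g a)"
    by (intro ext merge_mult_left)
  then show ?case
    using mult by (simp add: tree_span.mult)
qed

lemma tree_span_linear:
  assumes "f \<in> tree_span"
  shows "Vector_Spaces.linear scale (*) f"
  using assms
proof induction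
  case (tree T)
  show ?case
  proof (cases T)
    case Leaf
    then show ?thesis
      using linear by simp
  next
    case (Node l r)
    then show ?thesis
      using tree_span.tree
      by (simp add: linear_scale_iff Q_conv_R_coprod R_coprod_add R_coprod_scale form_tensor2_add
          form_tensor2_scale tree_span_integral_add tree_span_integral_mult add_divide_distrib)
  qed
qed (simp_all add: linear_scale_iff algebra_simps)


section \<open>Complete contractions\<close>

text \<open>Positions count from 0 here, so \<open>contract i\<close> corresponds to
  \<open>pull K (Suc i)\<close>.\<close>

definition contract :: "nat \<Rightarrow> ('x sym \<Rightarrow> complex) list \<Rightarrow> ('x sym \<Rightarrow> complex) list" where
  "contract i fs = take i fs @ merge (fs ! i) (fs ! Suc i) # drop (Suc (Suc i)) fs"

text \<open>Intended for lists of length \<open>n + 1\<close>: the sum over all \<open>n!\<close>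
  orders of merging neighbours down to a single form.\<close>

primrec contractions :: "nat \<Rightarrow> ('x sym \<Rightarrow> complex) list \<Rightarrow> 'x sym \<Rightarrow> complex" where
  "contractions 0 fs = hd fs"
| "contractions (Suc n) fs = (\<lambda>a. \<Sum>i\<le>n. contractions n (contract i fs) a)"

lemma length_contract [simp]: "Suc i < length fs \<Longrightarrow> length (contract i fs) = length fs - 1"
  by (simp add: contract_def)

lemma contract_tree_span:
  "set fs \<subseteq> tree_span \<Longrightarrow> Suc i < length fs \<Longrightarrow> set (contract i fs) \<subseteq> tree_span"
  using set_take_subset[of i fs] set_drop_subset[of "Suc (Suc i)" fs]
  by (auto simp: contract_def intro!: merge_tree_span)

lemma contractions_tree_span:
  "set fs \<subseteq> tree_span \<Longrightarrow> length fs = Suc n \<Longrightarrow> contractions n fs \<in> tree_span"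
proof (induction n arbitrary: fs)
  case 0
  then show ?case
    by (cases fs) auto
next
  case (Suc n)
  then show ?case
    unfolding contractions.simps by (intro tree_span_sum Suc.IH contract_tree_span) auto
qed

text \<open>A merge before the cut shortens the initial segment by one and leaves the rest
  alone.\<close>

lemma take_drop_contract_left:
  assumes "i \<le> j" "Suc j < length fs"
  shows "take (Suc j) (contract i fs) = contract i (take (Suc (Suc j)) fs)"
    and "drop (Suc j) (contract i fs) = drop (Suc (Suc j)) fs"
proof -
  have "Suc j - i = Suc (j - i)" "j - i + Suc (Suc i) = Suc (Suc j)"
    using assms by simp_all
  then show "take (Suc j) (contract i fs) = contract i (take (Suc (Suc j)) fs)"
    and "drop (Suc j) (contract i fs) = drop (Suc (Suc j)) fs"
    using assms by (simp_all add: contract_def min_def take_drop)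
qed

lemma take_drop_contract_right:
  assumes "Suc (Suc (j + i)) < length fs"
  shows "take (Suc j) (contract (Suc j + i) fs) = take (Suc j) fs"
    and "drop (Suc j) (contract (Suc j + i) fs) = contract i (drop (Suc j) fs)"
  using assms by (simp_all add: contract_def min_def drop_take add_ac)

text \<open>The last merge joins the complete contraction of an initial segment with that of the rest;
  the binomial coefficient counts the interleavings of the two.\<close>

lemma contractions_Suc:
  assumes "set fs \<subseteq> tree_span" "length fs = Suc (Suc n)"
  shows "contractions (Suc n) fs a = (\<Sum>j\<le>n. of_nat (n choose j) *
    merge (contractions j (take (Suc j) fs)) (contractions (n - j) (drop (Suc j) fs)) a)"
  using assms
proof (induction n arbitrary: fs)
  case 0
  then obtain f g where "fs = [f, g]"
    by (auto simp: length_Suc_conv)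
  then show ?case
    by (simp add: contract_def)
next
  case (Suc n)
  have len: "length fs = Suc (Suc (Suc n))" and span: "set fs \<subseteq> tree_span"
    using Suc.prems by simp_all
  have take_span: "set (take k fs) \<subseteq> tree_span" and drop_span: "set (drop k fs) \<subseteq> tree_span" for k
    using span set_take_subset[of k fs] set_drop_subset[of k fs] by auto
  \<comment> \<open>\<open>P j\<close> cuts the original list after \<open>j + 1\<close> forms;
    \<open>C j i\<close> merges at \<open>i\<close> first and then cuts after \<open>j + 1\<close>
    forms.\<close>
  define P where "P j =
    merge (contractions j (take (Suc j) fs)) (contractions (Suc n - j) (drop (Suc j) fs)) a" for j
  define C where "C j i = merge (contractions j (take (Suc j) (contract i fs)))
    (contractions (n - j) (drop (Suc j) (contract i fs))) a" for j i
  \<comment> \<open>First merges inside the initial \<open>j + 2\<close> forms add up to the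
    complete contraction of that segment, which puts the cut of \<open>fs\<close> one place
    later.\<close>
  have left: "(\<Sum>i\<le>j. C j i) = P (Suc j)" if j: "j \<le> n" for j
  proof -
    have "P (Suc j) = (\<Sum>i\<le>j. merge (contractions j (contract i (take (Suc (Suc j)) fs)))
        (contractions (n - j) (drop (Suc (Suc j)) fs)) a)"
      unfolding P_def contractions.simps diff_Suc_Suc
      by (rule merge_sum_left)
        (use j len in \<open>simp_all add: contractions_tree_span contract_tree_span take_span drop_span\<close>)
    then show ?thesis
      using j len by (simp add: C_def take_drop_contract_left)
  qed
  \<comment> \<open>First merges behind the cut complete the contraction of the remainder, and the
    cut keeps its place.\<close>
  have right: "(\<Sum>i\<le>n - j. C j (Suc j + i)) = P j" if j: "j \<le> n" for j
  proof -
    have "P j = (\<Sum>i\<le>n - j. merge (contractions j (take (Suc j) fs))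
        (contractions (n - j) (contract i (drop (Suc j) fs))) a)"
      unfolding P_def Suc_diff_le[OF j] contractions.simps
      by (rule merge_sum_right)
        (use j len in \<open>simp_all add: contractions_tree_span contract_tree_span take_span drop_span\<close>)
    then show ?thesis
      using j len by (simp add: C_def take_drop_contract_right del: add_Suc)
  qed
  have split: "(\<Sum>i\<le>Suc n. C j i) = P (Suc j) + P j" if j: "j \<le> n" for j
  proof -
    have "{..Suc n} = {..j} \<union> {Suc j..Suc n}"
      using j by auto
    then have "(\<Sum>i\<le>Suc n. C j i) = (\<Sum>i\<le>j. C j i) + (\<Sum>i=Suc j..Suc n. C j i)"
      by (simp only:) (rule sum.union_disjoint; auto)
    also have "(\<Sum>i=Suc j..Suc n. C j i) = (\<Sum>i\<le>n - j. C j (Suc j + i))"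
      using j by (intro sum.reindex_bij_witness[of _ "\<lambda>i. Suc j + i" "\<lambda>i. i - Suc j"]) auto
    finally show ?thesis
      using j by (simp only: left right)
  qed
  have "contractions (Suc (Suc n)) fs a = (\<Sum>i\<le>Suc n. \<Sum>j\<le>n. of_nat (n choose j) * C j i)"
    unfolding contractions.simps(2)[of "Suc n"]
  proof (rule sum.cong[OF refl])
    fix i assume "i \<in> {..Suc n}"
    then show "contractions (Suc n) (contract i fs) a = (\<Sum>j\<le>n. of_nat (n choose j) * C j i)"
      unfolding C_def using len span by (intro Suc.IH contract_tree_span) simp_all
  qed
  also have "\<dots> = (\<Sum>j\<le>n. of_nat (n choose j) * (\<Sum>i\<le>Suc n. C j i))"
    by (subst sum.swap) (simp only: sum_distrib_left)
  also have "\<dots> = (\<Sum>j\<le>n. of_nat (n choose j) * P (Suc j)) + (\<Sum>j\<le>n. of_nat (n choose j) * P j)"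
    by (simp add: split distrib_left sum.distrib del: sum.atMost_Suc)
  \<comment> \<open>The shifted sum gains the term with \<open>n choose Suc n\<close>, which is
    0.\<close>
  also have "(\<Sum>j\<le>n. of_nat (n choose j) * P j) =
      P 0 + (\<Sum>j\<le>n. of_nat (n choose Suc j) * P (Suc j))"
    using sum.atMost_Suc_shift[of "\<lambda>j. of_nat (n choose j) * P j" n] by (simp add: binomial_eq_0)
  \<comment> \<open>Pascal's rule.\<close>
  also have "(\<Sum>j\<le>n. of_nat (n choose j) * P (Suc j)) + (P 0 + (\<Sum>j\<le>n. of_nat (n choose Suc j) * P (Suc j))) =
      (\<Sum>j\<le>Suc n. of_nat (Suc n choose j) * P j)"
    by (simp add: sum.atMost_Suc_shift distrib_right sum.distrib del: sum.atMost_Suc)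
  finally show ?case
    by (simp only: P_def)
qed

text \<open>The factorial clears the factors \<open>1/k\<close> of \<open>Lambda\<close>. The list
  is arbitrary because after one merge the forms are no longer all equal.\<close>

lemma Lambda_product:
  assumes "set fs \<subseteq> tree_span" "length fs = Suc n"
  shows "fact n * Lambda K n a (lin_form (product fs)) = contractions n fs a"
  using assms
proof (induction n arbitrary: fs)
  case 0
  then obtain f where "fs = [f]" "f \<in> tree_span"
    by (auto simp: length_Suc_conv)
  then show ?case
    by (simp add: tens_of_sym_def lin_form_lin_map linear_conv_lin_form tree_span_linear)
next
  case (Suc n)
  have "fact n * Lambda K n a (lin_form (pull K (Suc i) (product fs))) = contractions n (contract i fs) a"
    if i: "i \<le> n" for i
  proof -
    have fs: "fs = take i fs @ fs ! i # fs ! Suc i # drop (Suc (Suc i)) fs"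
      using i Suc.prems(2) by (simp add: Cons_nth_drop_Suc)
    have "fs ! i \<in> tree_span" "fs ! Suc i \<in> tree_span"
      using Suc.prems i by auto
    then have "agree (Suc (length (take i fs) + length (drop (Suc (Suc i)) fs)))
        (pull K (Suc i) (product (take i fs @ fs ! i # fs ! Suc i # drop (Suc (Suc i)) fs)))
        (product (contract i fs))"
      unfolding contract_def merge_def
      using i Suc.prems(2) by (intro pull_product) (simp_all add: tree_span_integral_mult)
    then have "agree (Suc n) (pull K (Suc i) (product fs)) (product (contract i fs))"
      using i Suc.prems(2) by (simp flip: fs)
    then have "Lambda K n a (lin_form (pull K (Suc i) (product fs))) =
        Lambda K n a (lin_form (product (contract i fs)))"
      by (rule Lambda_cong)
    then show ?thesis
      using i Suc.prems by (simp add: Suc.IH contract_tree_span)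
  qed
  then have "contractions (Suc n) fs a =
      (\<Sum>i\<le>n. fact n * Lambda K n a (lin_form (pull K (Suc i) (product fs))))"
    by simp
  also have "\<dots> = fact n * (\<Sum>i = 1..Suc n. Lambda K n a (lin_form (pull K i (product fs))))"
    unfolding sum_distrib_left
    by (rule sum.reindex_bij_witness[of _ "\<lambda>i. i - 1" Suc]) auto
  also have "\<dots> = fact (Suc n) * Lambda K (Suc n) a (lin_form (product fs))"
    by (simp add: Q_at_lin_form del: of_nat_Suc)
  finally show ?case ..
qed

section \<open>The recursion for \<open>sigma\<close>\<close>

lemma sigma_Suc: "sigma K \<tau> (Suc n) a = Lambda K n a (lin_form (product (replicate (Suc n) \<tau>)))"
  unfolding sigma_def form_power_def diff_Suc_1 by (intro Lambda_cong form_power_agree)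

lemma replicate_tree_span: "set (replicate n \<tau>) \<subseteq> tree_span"
  using tree_span_tau by auto

lemma contractions_replicate: "contractions n (replicate (Suc n) \<tau>) = (\<lambda>a. fact n * sigma K \<tau> (Suc n) a)"
  unfolding sigma_Suc using Lambda_product[OF replicate_tree_span] by simp

lemma sigma_tree_span: "sigma K \<tau> (Suc n) \<in> tree_span"
proof -
  have "contractions n (replicate (Suc n) \<tau>) \<in> tree_span"
    by (intro contractions_tree_span replicate_tree_span) simp
  from mult[OF this, of "1 / fact n"] show ?thesis
    by (simp add: contractions_replicate del: replicate_Suc)
qed

lemma sigma_linear: "Vector_Spaces.linear scale (*) (sigma K \<tau> (Suc n))"
  by (rule tree_span_linear[OF sigma_tree_span])

lemma sigma_one: "sigma K \<tau> 1 = \<tau>"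
  using contractions_replicate[of 0] by simp

text \<open>Each contraction of \<open>j + 1\<close> copies contributes \<open>j!\<close>, and
  \<open>(n choose j) * j! * (n - j)! = n!\<close>, so all terms get equal weight; dividing by
  \<open>(n + 1)!\<close> leaves \<open>1/(n + 1)\<close>.\<close>

lemma sigma_rec:
  "sigma K \<tau> (Suc (Suc n)) a =
    1 / of_nat (Suc n) * (\<Sum>i = 1..Suc n. merge (sigma K \<tau> i) (sigma K \<tau> (Suc (Suc n) - i)) a)"
proof -
  have "fact (Suc n) * sigma K \<tau> (Suc (Suc n)) a =
      contractions (Suc n) (replicate (Suc (Suc n)) \<tau>) a"
    by (simp only: contractions_replicate)
  also have "\<dots> = (\<Sum>j\<le>n. of_nat (n choose j) *
      merge (contractions j (replicate (Suc j) \<tau>)) (contractions (n - j) (replicate (Suc (n - j)) \<tau>)) a)"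
    by (subst contractions_Suc[OF replicate_tree_span])
      (auto simp: min_def Suc_diff_le simp del: replicate_Suc intro!: sum.cong)
  also have "\<dots> = (\<Sum>j\<le>n. fact n * merge (sigma K \<tau> (Suc j)) (sigma K \<tau> (Suc (n - j))) a)"
  proof (rule sum.cong[OF refl])
    fix j assume "j \<in> {..n}"
    then have "of_nat (n choose j) * (fact j * fact (n - j)) = (fact n :: complex)"
      by (simp add: binomial_fact)
    then show "of_nat (n choose j) *
        merge (contractions j (replicate (Suc j) \<tau>)) (contractions (n - j) (replicate (Suc (n - j)) \<tau>)) a =
        fact n * merge (sigma K \<tau> (Suc j)) (sigma K \<tau> (Suc (n - j))) a"
      unfolding contractions_replicate
      by (simp add: merge_mult_left merge_mult_right sigma_tree_span mult mult.assoc[symmetric])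
  qed
  also have "\<dots> = fact n * (\<Sum>i = 1..Suc n. merge (sigma K \<tau> i) (sigma K \<tau> (Suc (Suc n) - i)) a)"
    unfolding sum_distrib_left
    by (rule sum.reindex_bij_witness[of _ "\<lambda>i. i - 1" Suc]) (auto simp: Suc_diff_le)
  finally have "fact n * (of_nat (Suc n) * sigma K \<tau> (Suc (Suc n)) a) =
      fact n * (\<Sum>i = 1..Suc n. merge (sigma K \<tau> i) (sigma K \<tau> (Suc (Suc n) - i)) a)"
    by (simp only: fact_Suc mult_ac)
  then have "of_nat (Suc n) * sigma K \<tau> (Suc (Suc n)) a =
      (\<Sum>i = 1..Suc n. merge (sigma K \<tau> i) (sigma K \<tau> (Suc (Suc n) - i)) a)"
    unfolding mult_cancel_left by simp
  then show ?thesis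
    by (simp only: times_divide_eq_left mult_1 nonzero_eq_divide_eq[OF of_nat_neq_0] mult.commute)
qed

end

text \<open>The last clause expresses that the recursion determines the forms. It follows by strong
  induction, since \<open>i\<close> and \<open>k - i\<close> both lie between 1 and
  \<open>k - 1\<close>.\<close>

theorem proposition12:
  fixes adm :: "((nat \<Rightarrow> 'x \<times> 'x) \<Rightarrow> complex) set"
    and G_inv :: "'x kernel"
    and G :: "'x \<Rightarrow> 'x \<Rightarrow> complex"
    and \<tau> :: "'x sym \<Rightarrow> complex"
  assumes kernel: "feynman_kernel adm G_inv G"
    and linear: "Vector_Spaces.linear scale (*) \<tau>"
    and tau_one: "\<tau> 1 = 0"
    and tau_phi: "\<And>x. \<tau> (phi x) = 0"
    and integrals: "integrals_exist adm \<tau>"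
  shows "(\<forall>k\<ge>1. Vector_Spaces.linear scale (*) (sigma G_inv \<tau> k)) \<and>
    sigma G_inv \<tau> 1 = \<tau> \<and>
    (\<forall>k>1. \<forall>a. sigma G_inv \<tau> k a =
      (1 / of_nat (k - 1)) *
        (\<Sum>i = 1..k - 1. Q G_inv a (form_tensor2 (sigma G_inv \<tau> i) (sigma G_inv \<tau> (k - i))))) \<and>
    (\<forall>s. s 1 = \<tau> \<and>
      (\<forall>k>1. \<forall>a. s k a =
        (1 / of_nat (k - 1)) * (\<Sum>i = 1..k - 1. Q G_inv a (form_tensor2 (s i) (s (k - i))))) \<longrightarrow>
      (\<forall>k\<ge>1. s k = sigma G_inv \<tau> k))"
proof -
  interpret feynman_form adm G_inv G \<tau>
    by (rule feynman_form.intro[OF kernel feynman_form_axioms.intro[OF linear integrals]])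
  have rec: "sigma G_inv \<tau> k a = (1 / of_nat (k - 1)) *
      (\<Sum>i = 1..k - 1. Q G_inv a (form_tensor2 (sigma G_inv \<tau> i) (sigma G_inv \<tau> (k - i))))"
    if k: "k > 1" for k a
  proof -
    obtain n where "k = Suc (Suc n)"
      using k by (metis One_nat_def less_imp_Suc_add add_Suc plus_1_eq_Suc)
    then show ?thesis
      using sigma_rec[of n a] by (simp only: merge_def diff_Suc_1)
  qed
  have unique: "s k = sigma G_inv \<tau> k"
    if one: "s 1 = \<tau>" and s: "\<forall>k>1. \<forall>a. s k a =
        (1 / of_nat (k - 1)) * (\<Sum>i = 1..k - 1. Q G_inv a (form_tensor2 (s i) (s (k - i))))"
      and "k \<ge> 1" for s k
    using \<open>k \<ge> 1\<close>
  proof (induction k rule: less_induct)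
    case (less k)
    show ?case
    proof (cases "k = 1")
      case True
      then show ?thesis
        using one sigma_one by simp
    next
      case False
      then have k: "k > 1"
        using less.prems by simp
      have "(\<Sum>i = 1..k - 1. Q G_inv a (form_tensor2 (s i) (s (k - i)))) =
          (\<Sum>i = 1..k - 1. Q G_inv a (form_tensor2 (sigma G_inv \<tau> i) (sigma G_inv \<tau> (k - i))))" for a
      proof (intro sum.cong refl)
        fix i assume "i \<in> {1..k - 1}"
        then have "s i = sigma G_inv \<tau> i" "s (k - i) = sigma G_inv \<tau> (k - i)"
          by (auto intro!: less.IH)
        then show "Q G_inv a (form_tensor2 (s i) (s (k - i))) =
            Q G_inv a (form_tensor2 (sigma G_inv \<tau> i) (sigma G_inv \<tau> (k - i)))"
          by simp
      qed
      then show ?thesis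
        using k s rec[OF k] by (intro ext) simp
    qed
  qed
  have "Vector_Spaces.linear scale (*) (sigma G_inv \<tau> k)" if "k \<ge> 1" for k
    using sigma_linear[of "k - 1"] that by simp
  then show ?thesis
    using sigma_one rec unique by blast
qed

end
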